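(* Let $C,D$ be concepts of $\mathcal{L}(\forall,\exists,\geq,-,\sqcap,\sqcup,\top,\bot,\neg)$ (i.e. $\mathcal{ALCQI}$) and let $\mathcal{O}$ be a DL-Lite ontology. Then $C\not\equiv_{\mathcal O} D$ if and only if there is a finite pointed interpretation $(\mathcal I,d)$ with $\mathcal I\models\mathcal O$ and $d\in((C\sqcap\neg D)\sqcup(\neg C\sqcap D))^{\mathcal I}$.
   Context: Concepts over finite sets of concept names and role names are built by $C,D ::= A \mid \top \mid \bot \mid C\sqcap D \mid C\sqcup D \mid \neg C \mid \exists S.C \mid \forall S.C \mid (\geq k\, S.C)$, where $A$ is a concept name, $k\ge 1$, and $S$ is a role name $R$ or its inverse $R^-$, with the standard semantics ($\geq k\,S.C$: at least $k$ pairwise distinct $S$-successors in $C$; $(R^-)^{\mathcal I}$ the converse of $R^{\mathcal I}$). A DL-Lite ontology is a finite set of inclusions $B\sqsubseteq C$ with $B ::= A\mid \exists R\mid\exists R^-$ ($\exists S$ abbreviates $\exists S.\top$) and $C ::= B\mid\neg B$; $\mathcal I\models\mathcal O$ if $B^{\mathcal I}\subseteq C^{\mathcal I}$ for all inclusions. $C\equiv_{\mathcal O}D$ means $C^{\mathcal I}=D^{\mathcal I}$ for all interpretations $\mathcal I\models\mathcal O$. A pointed interpretation $(\mathcal I,d)$ is finite if $\Delta^{\mathcal I}$ is finite. *)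

theory Defs
  imports Main
begin

datatype 'r role = Role 'r | Inv 'r

datatype ('c, 'r) concept =
    Name 'c
  | Top
  | Bot
  | Conj "('c, 'r) concept" "('c, 'r) concept"
  | Disj "('c, 'r) concept" "('c, 'r) concept"
  | Neg "('c, 'r) concept"
  | Exists "'r role" "('c, 'r) concept"
  | Forall "'r role" "('c, 'r) concept"
  | AtLeast nat "'r role" "('c, 'r) concept"

primrec role_over :: "'r set \<Rightarrow> 'r role \<Rightarrow> bool" where
  "role_over NR (Role R) \<longleftrightarrow> R \<in> NR"
| "role_over NR (Inv R) \<longleftrightarrow> R \<in> NR"

primrec concept_over :: "'c set \<Rightarrow> 'r set \<Rightarrow> ('c, 'r) concept \<Rightarrow> bool" where
  "concept_over NC NR (Name A) \<longleftrightarrow> A \<in> NC"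
| "concept_over NC NR Top \<longleftrightarrow> True"
| "concept_over NC NR Bot \<longleftrightarrow> True"
| "concept_over NC NR (Conj C D) \<longleftrightarrow> concept_over NC NR C \<and> concept_over NC NR D"
| "concept_over NC NR (Disj C D) \<longleftrightarrow> concept_over NC NR C \<and> concept_over NC NR D"
| "concept_over NC NR (Neg C) \<longleftrightarrow> concept_over NC NR C"
| "concept_over NC NR (Exists S C) \<longleftrightarrow> role_over NR S \<and> concept_over NC NR C"
| "concept_over NC NR (Forall S C) \<longleftrightarrow> role_over NR S \<and> concept_over NC NR C"
| "concept_over NC NR (AtLeast k S C) \<longleftrightarrow> 1 \<le> k \<and> role_over NR S \<and> concept_over NC NR C"

record ('d, 'c, 'r) interp =
  dom :: "'d set"
  con :: "'c \<Rightarrow> 'd set"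
  rol :: "'r \<Rightarrow> ('d \<times> 'd) set"

text \<open>Only the values at names of the signature matter.\<close>

definition interpretation_over :: "'c set \<Rightarrow> 'r set \<Rightarrow> ('d, 'c, 'r) interp \<Rightarrow> bool" where
  "interpretation_over NC NR I \<longleftrightarrow>
     dom I \<noteq> {} \<and>
     (\<forall>A\<in>NC. con I A \<subseteq> dom I) \<and>
     (\<forall>R\<in>NR. rol I R \<subseteq> dom I \<times> dom I)"

primrec role_ext :: "('d, 'c, 'r) interp \<Rightarrow> 'r role \<Rightarrow> ('d \<times> 'd) set" where
  "role_ext I (Role R) = rol I R"
| "role_ext I (Inv R) = (rol I R)\<inverse>"

primrec ext :: "('d, 'c, 'r) interp \<Rightarrow> ('c, 'r) concept \<Rightarrow> 'd set" where
  "ext I (Name A) = con I A"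
| "ext I Top = dom I"
| "ext I Bot = {}"
| "ext I (Conj C D) = ext I C \<inter> ext I D"
| "ext I (Disj C D) = ext I C \<union> ext I D"
| "ext I (Neg C) = dom I - ext I C"
| "ext I (Exists S C) = {d \<in> dom I. \<exists>e. (d, e) \<in> role_ext I S \<and> e \<in> ext I C}"
| "ext I (Forall S C) = {d \<in> dom I. \<forall>e. (d, e) \<in> role_ext I S \<longrightarrow> e \<in> ext I C}"
| "ext I (AtLeast k S C) =
     {d \<in> dom I. \<exists>X. finite X \<and> card X = k \<and> X \<subseteq> {e. (d, e) \<in> role_ext I S \<and> e \<in> ext I C}}"

text \<open>An inclusion \<open>B \<sqsubseteq> C\<close> is the pair \<open>(B, C)\<close>.\<close>

type_synonym ('c, 'r) ontology = "(('c, 'r) concept \<times> ('c, 'r) concept) set"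

definition basic_concept :: "'c set \<Rightarrow> 'r set \<Rightarrow> ('c, 'r) concept \<Rightarrow> bool" where
  "basic_concept NC NR B \<longleftrightarrow>
     (\<exists>A\<in>NC. B = Name A) \<or>
     (\<exists>R\<in>NR. B = Exists (Role R) Top) \<or>
     (\<exists>R\<in>NR. B = Exists (Inv R) Top)"

definition dl_lite_ontology :: "'c set \<Rightarrow> 'r set \<Rightarrow> ('c, 'r) ontology \<Rightarrow> bool" where
  "dl_lite_ontology NC NR \<O> \<longleftrightarrow>
     finite \<O> \<and>
     (\<forall>(B, C)\<in>\<O>. basic_concept NC NR B \<and>
        (basic_concept NC NR C \<or> (\<exists>B'. basic_concept NC NR B' \<and> C = Neg B')))"

definition satisfies :: "('d, 'c, 'r) interp \<Rightarrow> ('c, 'r) ontology \<Rightarrow> bool" where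
  "satisfies I \<O> \<longleftrightarrow> (\<forall>(B, C)\<in>\<O>. ext I B \<subseteq> ext I C)"

text \<open>
  HOL cannot quantify over all types inside a formula, so equivalence is indexed by the type
  of which interpretation domains are (arbitrary nonempty) subsets. It is meaningful only when
  that type is large enough, in particular infinite.
\<close>

definition equiv_wrt ::
  "'d itself \<Rightarrow> 'c set \<Rightarrow> 'r set \<Rightarrow> ('c, 'r) ontology \<Rightarrow>
   ('c, 'r) concept \<Rightarrow> ('c, 'r) concept \<Rightarrow> bool" where
  "equiv_wrt _ NC NR \<O> C D \<longleftrightarrow>
     (\<forall>I :: ('d, 'c, 'r) interp.
        interpretation_over NC NR I \<and> satisfies I \<O> \<longrightarrow> ext I C = ext I D)"

end

theory Submission imports Defs begin

text \<open>
  Let \<open>d\<close> satisfy \<open>E\<close> in a model \<open>I\<close> of the ontology, and let \<open>n\<close> be the role depth of \<open>E\<close>. Copy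
  elements of \<open>I\<close> into layers \<open>0, \<dots>, n\<close>: layer \<open>i + 1\<close> extends layer \<open>i\<close> by finitely many successors
  of each of its elements, enough to witness the number restrictions in \<open>E\<close>. An element of layer
  \<open>i < n\<close> is linked to its witnesses in layer \<open>i + 1\<close>, except for those from which it is already
  linked in layer \<open>i - 1\<close>, so that no successor is counted twice. A copy in layer \<open>i\<close> then agrees
  with its original on the relevant concepts of depth at most \<open>n - i\<close>.

  DL-Lite inclusions neither count nor qualify, so for the ontology to hold it is enough that a copy
  has some \<open>S\<close>-successor if and only if its original has one. In the last layer this is achieved by
  linking the whole domain of \<open>S\<close> to its whole range, once layer \<open>0\<close> meets the range of every
  nonempty role.
\<close>

section \<open>Cardinality lower bounds\<close>

definition at_least :: "nat \<Rightarrow> 'a set \<Rightarrow> bool" where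
  "at_least k A \<longleftrightarrow> (\<exists>X\<subseteq>A. finite X \<and> card X = k)"

lemma at_least_mono: "at_least k A \<Longrightarrow> A \<subseteq> B \<Longrightarrow> at_least k B"
  unfolding at_least_def by blast

lemma at_least_one_iff: "at_least 1 A \<longleftrightarrow> A \<noteq> {}"
proof
  assume "A \<noteq> {}"
  then obtain a where "a \<in> A" by blast
  then show "at_least 1 A" unfolding at_least_def by (intro exI[of _ "{a}"]) simp
qed (auto simp: at_least_def)

lemma at_least_image_iff:
  assumes "inj_on f A"
  shows "at_least k (f ` A) \<longleftrightarrow> at_least k A"
proof -
  have inj: "inj_on f X" if "X \<subseteq> A" for X
    using assms that by (rule inj_on_subset)
  have "at_least k (f ` A) \<longleftrightarrow> (\<exists>X\<subseteq>A. finite (f ` X) \<and> card (f ` X) = k)"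
    unfolding at_least_def by (auto simp: subset_image_iff)
  also have "\<dots> \<longleftrightarrow> at_least k A"
    unfolding at_least_def using inj by (metis card_image finite_image_iff)
  finally show ?thesis .
qed

definition finite_witnesses :: "(nat \<times> 'a set) set \<Rightarrow> 'a set \<Rightarrow> 'a set \<Rightarrow> bool" where
  "finite_witnesses \<Sigma> A W \<longleftrightarrow>
     finite W \<and> W \<subseteq> A \<and> (\<forall>(k, B)\<in>\<Sigma>. at_least k (A \<inter> B) \<longrightarrow> at_least k (W \<inter> B))"

lemma finite_witnesses_exists:
  assumes "finite \<Sigma>"
  shows "\<exists>W. finite_witnesses \<Sigma> A W"
  using assms
proof (induction \<Sigma>)
  case empty
  show ?case by (intro exI[of _ "{}"]) (simp add: finite_witnesses_def)
next
  case (insert p \<Sigma>)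
  obtain W where W: "finite_witnesses \<Sigma> A W" using insert.IH by blast
  obtain k B where p: "p = (k, B)" by (cases p)
  show ?case
  proof (cases "at_least k (A \<inter> B)")
    case True
    then obtain X where X: "X \<subseteq> A \<inter> B" "finite X" "card X = k"
      unfolding at_least_def by blast
    have "at_least k ((W \<union> X) \<inter> B)"
      unfolding at_least_def using X by blast
    moreover have "at_least j ((W \<union> X) \<inter> C)" if "at_least j (W \<inter> C)" for j C
      using that by (rule at_least_mono) blast
    ultimately have "finite_witnesses (insert p \<Sigma>) A (W \<union> X)"
      using W X unfolding finite_witnesses_def p by auto
    then show ?thesis ..
  next
    case False
    then have "finite_witnesses (insert p \<Sigma>) A W"
      using W unfolding finite_witnesses_def p by simp
    then show ?thesis ..
  qed
qed

section \<open>Roles and concepts\<close>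

primrec inv_role :: "'r role \<Rightarrow> 'r role" where
  "inv_role (Role R) = Inv R"
| "inv_role (Inv R) = Role R"

lemma role_ext_inv_role [simp]: "role_ext I (inv_role S) = (role_ext I S)\<inverse>"
  by (cases S) auto

lemma finite_role_over:
  assumes "finite NR"
  shows "finite {S. role_over NR S}"
proof (rule finite_subset)
  show "{S. role_over NR S} \<subseteq> Role ` NR \<union> Inv ` NR"
  proof
    fix S assume "S \<in> {S. role_over NR S}"
    then show "S \<in> Role ` NR \<union> Inv ` NR" by (cases S) auto
  qed
  show "finite (Role ` NR \<union> Inv ` NR)" using assms by simp
qed

lemma role_ext_subset_dom:
  assumes "interpretation_over NC NR I" "role_over NR S"
  shows "role_ext I S \<subseteq> dom I \<times> dom I"
  using assms by (cases S) (auto simp: interpretation_over_def)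

lemma ext_subset_dom:
  assumes "interpretation_over NC NR I" "concept_over NC NR E"
  shows "ext I E \<subseteq> dom I"
  using assms by (induction E) (auto simp: interpretation_over_def)

lemma ext_Exists_at_least:
  "ext I (Exists S E) = {x \<in> dom I. at_least 1 (role_ext I S `` {x} \<inter> ext I E)}"
  unfolding at_least_one_iff by auto

lemma ext_Forall_at_least:
  "ext I (Forall S E) = {x \<in> dom I. \<not> at_least 1 (role_ext I S `` {x} \<inter> - ext I E)}"
  unfolding at_least_one_iff by auto

lemma ext_AtLeast_at_least:
  "ext I (AtLeast k S E) = {x \<in> dom I. at_least k (role_ext I S `` {x} \<inter> ext I E)}"
proof -
  have "role_ext I S `` {x} \<inter> ext I E = {e. (x, e) \<in> role_ext I S \<and> e \<in> ext I E}" for x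
    by blast
  then show ?thesis by (auto simp: at_least_def)
qed

lemma ext_Exists_Top:
  assumes "interpretation_over NC NR I" "role_over NR S"
  shows "ext I (Exists S Top) = Domain (role_ext I S)"
  using role_ext_subset_dom[OF assms] by auto

lemma concept_over_basic_concept: "basic_concept NC NR B \<Longrightarrow> concept_over NC NR B"
  by (auto simp: basic_concept_def)

lemma basic_concept_cases:
  assumes "basic_concept NC NR B"
  obtains (Name) A where "A \<in> NC" "B = Name A"
    | (Exists) S where "role_over NR S" "B = Exists S Top"
  using assms unfolding basic_concept_def by (metis role_over.simps)

lemma satisfies_if_basic_concepts_agree:
  assumes O: "dl_lite_ontology NC NR \<O>" and sat: "satisfies I \<O>"
    and J: "interpretation_over NC NR J"
    and agree: "\<And>v. v \<in> dom J \<Longrightarrow>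
      \<exists>x\<in>dom I. \<forall>B. basic_concept NC NR B \<longrightarrow> (v \<in> ext J B \<longleftrightarrow> x \<in> ext I B)"
  shows "satisfies J \<O>"
  unfolding satisfies_def
proof clarify
  fix B C v assume BC: "(B, C) \<in> \<O>" and v: "v \<in> ext J B"
  have B: "basic_concept NC NR B"
    and C: "basic_concept NC NR C \<or> (\<exists>B'. basic_concept NC NR B' \<and> C = Neg B')"
    using O BC by (auto simp: dl_lite_ontology_def)
  have v_dom: "v \<in> dom J"
    using ext_subset_dom[OF J concept_over_basic_concept[OF B]] v by blast
  then obtain x where x: "x \<in> dom I"
    and x_agrees: "\<And>B. basic_concept NC NR B \<Longrightarrow> v \<in> ext J B \<longleftrightarrow> x \<in> ext I B"
    using agree by blast
  have "x \<in> ext I C" using sat BC v x_agrees[OF B] by (auto simp: satisfies_def)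
  then show "v \<in> ext J C" using C v_dom x x_agrees by auto
qed

section \<open>Maps preserving concepts of bounded role depth\<close>

primrec role_depth :: "('c, 'r) concept \<Rightarrow> nat" where
  "role_depth (Name A) = 0"
| "role_depth Top = 0"
| "role_depth Bot = 0"
| "role_depth (Conj C D) = max (role_depth C) (role_depth D)"
| "role_depth (Disj C D) = max (role_depth C) (role_depth D)"
| "role_depth (Neg C) = role_depth C"
| "role_depth (Exists S C) = Suc (role_depth C)"
| "role_depth (Forall S C) = Suc (role_depth C)"
| "role_depth (AtLeast k S C) = Suc (role_depth C)"

text \<open>
  A pair \<open>(k, A)\<close> asks for \<open>k\<close> successors in \<open>A\<close>; a universal restriction is refuted by one successor
  in the complement.
\<close>

primrec demands :: "('d, 'c, 'r) interp \<Rightarrow> ('c, 'r) concept \<Rightarrow> (nat \<times> 'd set) set" where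
  "demands I (Name A) = {}"
| "demands I Top = {}"
| "demands I Bot = {}"
| "demands I (Conj C D) = demands I C \<union> demands I D"
| "demands I (Disj C D) = demands I C \<union> demands I D"
| "demands I (Neg C) = demands I C"
| "demands I (Exists S C) = insert (1, ext I C) (demands I C)"
| "demands I (Forall S C) = insert (1, - ext I C) (demands I C)"
| "demands I (AtLeast k S C) = insert (k, ext I C) (demands I C)"

lemma finite_demands: "finite (demands I E)"
  by (induction E) auto

text \<open>\<open>V i\<close> consists of elements at which concepts of role depth up to \<open>i\<close> are preserved.\<close>

locale bounded_depth_morphism =
  fixes NC :: "'c set" and NR :: "'r set"
    and J :: "('e, 'c, 'r) interp" and I :: "('d, 'c, 'r) interp"
    and h :: "'e \<Rightarrow> 'd" and V :: "nat \<Rightarrow> 'e set" and \<Sigma> :: "(nat \<times> 'd set) set"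
  assumes in_dom: "v \<in> V i \<Longrightarrow> v \<in> dom J"
    and image_in_dom: "v \<in> V i \<Longrightarrow> h v \<in> dom I"
    and con_iff: "v \<in> V i \<Longrightarrow> A \<in> NC \<Longrightarrow> v \<in> con J A \<longleftrightarrow> h v \<in> con I A"
    and successors_subset_V: "v \<in> V (Suc i) \<Longrightarrow> role_over NR S \<Longrightarrow> role_ext J S `` {v} \<subseteq> V i"
    and inj_on_successors: "v \<in> V (Suc i) \<Longrightarrow> role_over NR S \<Longrightarrow> inj_on h (role_ext J S `` {v})"
    and image_successors_subset:
      "v \<in> V (Suc i) \<Longrightarrow> role_over NR S \<Longrightarrow> h ` (role_ext J S `` {v}) \<subseteq> role_ext I S `` {h v}"
    and demand_met: "v \<in> V (Suc i) \<Longrightarrow> role_over NR S \<Longrightarrow> (k, B) \<in> \<Sigma> \<Longrightarrow>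
      at_least k (role_ext I S `` {h v} \<inter> B) \<Longrightarrow> at_least k (h ` (role_ext J S `` {v}) \<inter> B)"
begin

lemma at_least_successors_iff:
  assumes v: "v \<in> V (Suc i)" and S: "role_over NR S" and "(k, A) \<in> \<Sigma>"
    and P: "\<And>u. u \<in> V i \<Longrightarrow> u \<in> P \<longleftrightarrow> h u \<in> A"
  shows "at_least k (role_ext J S `` {v} \<inter> P) \<longleftrightarrow> at_least k (role_ext I S `` {h v} \<inter> A)"
proof -
  let ?succs = "role_ext J S `` {v}"
  have "inj_on h (?succs \<inter> P)"
    using inj_on_successors[OF v S] by (rule inj_on_subset) blast
  then have "at_least k (?succs \<inter> P) \<longleftrightarrow> at_least k (h ` (?succs \<inter> P))"
    by (rule at_least_image_iff[symmetric])
  also have "h ` (?succs \<inter> P) = h ` ?succs \<inter> A"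
    using successors_subset_V[OF v S] P by blast
  also have "at_least k (h ` ?succs \<inter> A) \<longleftrightarrow> at_least k (role_ext I S `` {h v} \<inter> A)"
    using demand_met[OF v S \<open>(k, A) \<in> \<Sigma>\<close>] image_successors_subset[OF v S]
    by (meson Int_mono at_least_mono order_refl)
  finally show ?thesis .
qed

theorem ext_iff:
  assumes "concept_over NC NR E" "demands I E \<subseteq> \<Sigma>" "v \<in> V i" "role_depth E \<le> i"
  shows "v \<in> ext J E \<longleftrightarrow> h v \<in> ext I E"
  using assms
proof (induction E arbitrary: i v)
  case (Exists S E)
  then obtain j where j: "i = Suc j" "role_depth E \<le> j" by (cases i) auto
  then have "at_least 1 (role_ext J S `` {v} \<inter> ext J E) \<longleftrightarrow>
      at_least 1 (role_ext I S `` {h v} \<inter> ext I E)"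
    using Exists by (intro at_least_successors_iff) auto
  then show ?case
    unfolding ext_Exists_at_least using Exists.prems in_dom image_in_dom by blast
next
  case (Forall S E)
  then obtain j where j: "i = Suc j" "role_depth E \<le> j" by (cases i) auto
  then have "at_least 1 (role_ext J S `` {v} \<inter> - ext J E) \<longleftrightarrow>
      at_least 1 (role_ext I S `` {h v} \<inter> - ext I E)"
    using Forall by (intro at_least_successors_iff) auto
  then show ?case
    unfolding ext_Forall_at_least using Forall.prems in_dom image_in_dom by blast
next
  case (AtLeast k S E)
  then obtain j where j: "i = Suc j" "role_depth E \<le> j" by (cases i) auto
  then have "at_least k (role_ext J S `` {v} \<inter> ext J E) \<longleftrightarrow>
      at_least k (role_ext I S `` {h v} \<inter> ext I E)"
    using AtLeast by (intro at_least_successors_iff) auto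
  then show ?case
    unfolding ext_AtLeast_at_least using AtLeast.prems in_dom image_in_dom by blast
qed (auto simp: con_iff in_dom image_in_dom)

end

section \<open>Isomorphic copies\<close>

definition image_interp :: "('d \<Rightarrow> 'e) \<Rightarrow> ('d, 'c, 'r) interp \<Rightarrow> ('e, 'c, 'r) interp" where
  "image_interp f I =
     \<lparr>dom = f ` dom I, con = \<lambda>A. f ` con I A, rol = \<lambda>R. map_prod f f ` rol I R\<rparr>"

lemma dom_image_interp [simp]: "dom (image_interp f I) = f ` dom I"
  by (simp add: image_interp_def)

lemma role_ext_image_interp: "role_ext (image_interp f I) S = map_prod f f ` role_ext I S"
  by (cases S) (force simp: image_interp_def)+

lemma interpretation_over_image_interp:
  "interpretation_over NC NR I \<Longrightarrow> interpretation_over NC NR (image_interp f I)"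
  unfolding interpretation_over_def image_interp_def by fastforce

lemma successors_image_interp:
  assumes "interpretation_over NC NR I" "role_over NR S" "inj_on f (dom I)" "x \<in> dom I"
  shows "role_ext (image_interp f I) S `` {f x} = f ` (role_ext I S `` {x})"
proof -
  have "y = x" if "(y, e) \<in> role_ext I S" "f y = f x" for y e
    using role_ext_subset_dom[OF assms(1,2)] that assms(3,4) by (auto dest: inj_onD)
  then show ?thesis unfolding role_ext_image_interp by force
qed

lemma ext_image_interp_iff:
  assumes I: "interpretation_over NC NR I" and inj: "inj_on f (dom I)"
    and E: "concept_over NC NR E" and x: "x \<in> dom I"
  shows "f x \<in> ext (image_interp f I) E \<longleftrightarrow> x \<in> ext I E"
proof -
  interpret bounded_depth_morphism NC NR I "image_interp f I" f "\<lambda>_. dom I" UNIV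
  proof
    fix x A assume "x \<in> dom I" "A \<in> NC"
    then show "x \<in> con I A \<longleftrightarrow> f x \<in> con (image_interp f I) A"
      using I inj by (auto simp: image_interp_def interpretation_over_def inj_on_image_mem_iff)
  next
    fix x S assume x: "x \<in> dom I" and S: "role_over NR S"
    show succs: "role_ext I S `` {x} \<subseteq> dom I"
      using role_ext_subset_dom[OF I S] by blast
    show "inj_on f (role_ext I S `` {x})"
      using inj succs by (rule inj_on_subset)
    show "f ` (role_ext I S `` {x}) \<subseteq> role_ext (image_interp f I) S `` {f x}"
      "at_least k (role_ext (image_interp f I) S `` {f x} \<inter> A) \<Longrightarrow>
        at_least k (f ` (role_ext I S `` {x}) \<inter> A)" for k A
      by (simp_all add: successors_image_interp[OF I S inj x])
  qed simp_all
  show ?thesis using ext_iff[OF E _ x] by blast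
qed

lemma satisfies_image_interp:
  assumes I: "interpretation_over NC NR I" and inj: "inj_on f (dom I)"
    and O: "dl_lite_ontology NC NR \<O>" and sat: "satisfies I \<O>"
  shows "satisfies (image_interp f I) \<O>"
  using O sat interpretation_over_image_interp[OF I]
proof (rule satisfies_if_basic_concepts_agree)
  fix v assume "v \<in> dom (image_interp f I)"
  then obtain x where "x \<in> dom I" "v = f x" by auto
  then show "\<exists>x\<in>dom I. \<forall>B. basic_concept NC NR B \<longrightarrow>
      (v \<in> ext (image_interp f I) B \<longleftrightarrow> x \<in> ext I B)"
    using ext_image_interp_iff[OF I inj concept_over_basic_concept] by blast
qed

section \<open>The layered copy\<close>

locale layered_copy =
  fixes NC :: "'c set" and NR :: "'r set" and I :: "('d, 'c, 'r) interp"
    and n :: nat and base :: "'d set"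
    and \<Sigma> :: "(nat \<times> 'd set) set" and wit :: "'r role \<Rightarrow> 'd \<Rightarrow> 'd set"
  assumes finite_NR: "finite NR"
    and interp: "interpretation_over NC NR I"
    and finite_base: "finite base"
    and base_nonempty: "base \<noteq> {}"
    and base_subset_dom: "base \<subseteq> dom I"
    and base_meets_Range:
      "role_over NR S \<Longrightarrow> role_ext I S \<noteq> {} \<Longrightarrow> base \<inter> Range (role_ext I S) \<noteq> {}"
    and some_successor_demanded: "(1, UNIV) \<in> \<Sigma>"
    and finite_witnesses_wit: "finite_witnesses \<Sigma> (role_ext I S `` {x}) (wit S x)"
begin

lemma finite_wit: "finite (wit S x)"
  and wit_subset: "wit S x \<subseteq> role_ext I S `` {x}"
  using finite_witnesses_wit by (auto simp: finite_witnesses_def)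

lemma at_least_wit:
  "(k, A) \<in> \<Sigma> \<Longrightarrow> at_least k (role_ext I S `` {x} \<inter> A) \<Longrightarrow> at_least k (wit S x \<inter> A)"
  using finite_witnesses_wit unfolding finite_witnesses_def by blast

lemma wit_nonempty: "x \<in> Domain (role_ext I S) \<Longrightarrow> wit S x \<noteq> {}"
  using at_least_wit[OF some_successor_demanded, of S x] unfolding at_least_one_iff by auto

primrec layer :: "nat \<Rightarrow> 'd set" where
  "layer 0 = base"
| "layer (Suc i) = layer i \<union> (\<Union>S\<in>{S. role_over NR S}. \<Union>x\<in>layer i. wit S x)"

primrec link :: "nat \<Rightarrow> 'r role \<Rightarrow> ('d \<times> 'd) set" where
  "link 0 S = {(x, y). x \<in> layer 0 \<and> y \<in> wit S x}"
| "link (Suc i) S =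
     {(x, y). x \<in> layer (Suc i) \<and> y \<in> wit S x \<and> (y, x) \<notin> link i (inv_role S)}"

definition nodes :: "(nat \<times> 'd) set" where
  "nodes = (SIGMA i:{..n}. layer i)"

definition down :: "'r role \<Rightarrow> ((nat \<times> 'd) \<times> (nat \<times> 'd)) set" where
  "down S = {((i, x), (Suc i, y)) |i x y. i < n \<and> (x, y) \<in> link i S}"

definition across :: "'r role \<Rightarrow> ((nat \<times> 'd) \<times> (nat \<times> 'd)) set" where
  "across S = {((n, x), (n, y)) |x y.
     x \<in> layer n \<inter> Domain (role_ext I S) \<and> y \<in> layer n \<inter> Range (role_ext I S)}"

definition layered :: "(nat \<times> 'd, 'c, 'r) interp" where
  "layered = \<lparr>dom = nodes, con = \<lambda>A. {v \<in> nodes. snd v \<in> con I A},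
     rol = \<lambda>R. down (Role R) \<union> (down (Inv R))\<inverse> \<union> across (Role R)\<rparr>"

lemma dom_layered [simp]: "dom layered = nodes"
  by (simp add: layered_def)

lemma role_ext_layered: "role_ext layered S = down S \<union> (down (inv_role S))\<inverse> \<union> across S"
  by (cases S) (auto simp: layered_def across_def)

lemma base_subset_layer: "base \<subseteq> layer i"
  by (induction i) auto

lemma finite_layer: "finite (layer i)"
  by (induction i) (simp_all add: finite_base finite_wit finite_role_over[OF finite_NR])

lemma finite_nodes: "finite nodes"
  by (simp add: nodes_def finite_layer)

lemma wit_subset_layer: "x \<in> layer i \<Longrightarrow> role_over NR S \<Longrightarrow> wit S x \<subseteq> layer (Suc i)"
  by auto

lemma layer_subset_dom: "layer i \<subseteq> dom I"
proof (induction i)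
  case (Suc i)
  have "wit S x \<subseteq> dom I" if "role_over NR S" for S x
    using wit_subset role_ext_subset_dom[OF interp that] by blast
  then show ?case using Suc by auto
qed (simp add: base_subset_dom)

lemma snd_in_dom: "v \<in> nodes \<Longrightarrow> snd v \<in> dom I"
  using layer_subset_dom[of "fst v"] by (auto simp: nodes_def)

lemma linkD:
  assumes "(x, y) \<in> link i S"
  shows "x \<in> layer i" "y \<in> wit S x" "(x, y) \<in> role_ext I S"
proof -
  show "x \<in> layer i" "y \<in> wit S x" using assms by (cases i; simp)+
  then show "(x, y) \<in> role_ext I S" using wit_subset by blast
qed

lemma down_subset:
  assumes "role_over NR S"
  shows "down S \<subseteq> nodes \<times> nodes"
proof -
  have "x \<in> layer i \<and> y \<in> layer (Suc i)" if "(x, y) \<in> link i S" for i x y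
    using linkD(1,2)[OF that] wit_subset_layer[OF _ assms] by blast
  then show ?thesis by (auto simp: down_def nodes_def simp del: layer.simps)
qed

lemma across_subset: "across S \<subseteq> nodes \<times> nodes"
  by (auto simp: across_def nodes_def)

lemma interpretation_over_layered: "interpretation_over NC NR layered"
proof -
  have "rol layered R \<subseteq> nodes \<times> nodes" if "R \<in> NR" for R
    using that down_subset[of "Role R"] down_subset[of "Inv R"] across_subset[of "Role R"]
    by (auto simp: layered_def)
  moreover have "nodes \<noteq> {}"
    using base_nonempty base_subset_layer[of n] by (auto simp: nodes_def)
  ultimately show ?thesis
    by (auto simp: interpretation_over_def layered_def)
qed

lemma successors_layered:
  assumes "i < n"
  shows "role_ext layered S `` {(i, x)} =
    {(Suc i, y) |y. (x, y) \<in> link i S} \<union> {(j, y) |j y. i = Suc j \<and> (y, x) \<in> link j (inv_role S)}"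
  using assms by (auto simp: role_ext_layered down_def across_def)

lemma inj_on_snd_successors_layered:
  assumes "i < n"
  shows "inj_on snd (role_ext layered S `` {(i, x)})"
proof -
  have "(x, y) \<notin> link i S" if "i = Suc j" "(y, x) \<in> link j (inv_role S)" for j y
    using that by simp
  then show ?thesis unfolding successors_layered[OF assms] by (auto simp: inj_on_def)
qed

lemma snd_successors_layered_subset:
  assumes "i < n"
  shows "snd ` (role_ext layered S `` {(i, x)}) \<subseteq> role_ext I S `` {x}"
  unfolding successors_layered[OF assms] using linkD(3) by fastforce

lemma wit_subset_snd_successors_layered:
  assumes "i < n" "x \<in> layer i"
  shows "wit S x \<subseteq> snd ` (role_ext layered S `` {(i, x)})"
proof
  fix y assume y: "y \<in> wit S x"
  have "(x, y) \<in> link i S \<or> (\<exists>j. i = Suc j \<and> (y, x) \<in> link j (inv_role S))"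
    using assms y by (cases i) auto
  then show "y \<in> snd ` (role_ext layered S `` {(i, x)})"
    unfolding successors_layered[OF assms(1)] by force
qed

sublocale original: bounded_depth_morphism NC NR layered I snd "\<lambda>m. {v \<in> nodes. fst v + m \<le> n}" \<Sigma>
proof
  fix v m A assume "v \<in> {v \<in> nodes. fst v + m \<le> n}"
  then show "v \<in> dom layered" "snd v \<in> dom I" "v \<in> con layered A \<longleftrightarrow> snd v \<in> con I A"
    using snd_in_dom by (simp_all add: layered_def)
next
  fix v m S assume v: "v \<in> {v \<in> nodes. fst v + Suc m \<le> n}" and S: "role_over NR S"
  obtain i x where ix: "v = (i, x)" "x \<in> layer i" "i + m < n"
    using v by (auto simp: nodes_def)
  then have i: "i < n" by simp
  have "role_ext layered S `` {v} \<subseteq> nodes"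
    using role_ext_subset_dom[OF interpretation_over_layered S] by auto
  then show "role_ext layered S `` {v} \<subseteq> {v \<in> nodes. fst v + m \<le> n}"
    using ix(3) unfolding ix(1) successors_layered[OF i] by auto
  show "inj_on snd (role_ext layered S `` {v})"
    using inj_on_snd_successors_layered[OF i] ix(1) by simp
  show "snd ` (role_ext layered S `` {v}) \<subseteq> role_ext I S `` {snd v}"
    using snd_successors_layered_subset[OF i] ix(1) by simp
  fix k B assume "(k, B) \<in> \<Sigma>" "at_least k (role_ext I S `` {snd v} \<inter> B)"
  then have "at_least k (wit S (snd v) \<inter> B)" by (rule at_least_wit)
  moreover have "wit S (snd v) \<subseteq> snd ` (role_ext layered S `` {v})"
    using wit_subset_snd_successors_layered[OF i ix(2)] ix(1) by simp
  ultimately show "at_least k (snd ` (role_ext layered S `` {v}) \<inter> B)"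
    by (meson Int_mono at_least_mono order_refl)
qed

lemma Domain_layered_iff:
  assumes v: "(i, x) \<in> nodes" and S: "role_over NR S"
  shows "(i, x) \<in> Domain (role_ext layered S) \<longleftrightarrow> x \<in> Domain (role_ext I S)"
proof
  assume "(i, x) \<in> Domain (role_ext layered S)"
  then show "x \<in> Domain (role_ext I S)"
    using linkD(3) by (fastforce simp: role_ext_layered down_def across_def)
next
  assume x: "x \<in> Domain (role_ext I S)"
  have "x \<in> layer i" "i \<le> n" using v by (auto simp: nodes_def)
  show "(i, x) \<in> Domain (role_ext layered S)"
  proof (cases "i < n")
    case True
    then show ?thesis
      using wit_nonempty[OF x] wit_subset_snd_successors_layered[OF True \<open>x \<in> layer i\<close>] by blast
  next
    case False
    obtain y where "y \<in> base" "y \<in> Range (role_ext I S)"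
      using base_meets_Range[OF S] x by blast
    then have "((n, x), (n, y)) \<in> across S"
      using False x \<open>x \<in> layer i\<close> \<open>i \<le> n\<close> base_subset_layer by (auto simp: across_def)
    then show ?thesis using False \<open>i \<le> n\<close> by (auto simp: role_ext_layered)
  qed
qed

lemma basic_concept_layered_iff:
  assumes "basic_concept NC NR B" "(i, x) \<in> nodes"
  shows "(i, x) \<in> ext layered B \<longleftrightarrow> x \<in> ext I B"
  using assms(1)
proof (cases rule: basic_concept_cases)
  case (Name A)
  then show ?thesis using assms(2) by (simp add: layered_def)
next
  case (Exists S)
  then show ?thesis
    using Domain_layered_iff[OF assms(2)] ext_Exists_Top interp interpretation_over_layered by metis
qed

lemma satisfies_layered:
  assumes "dl_lite_ontology NC NR \<O>" "satisfies I \<O>"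
  shows "satisfies layered \<O>"
  using assms interpretation_over_layered
proof (rule satisfies_if_basic_concepts_agree)
  fix v assume "v \<in> dom layered"
  then have "v \<in> nodes" by simp
  then show "\<exists>x\<in>dom I. \<forall>B. basic_concept NC NR B \<longrightarrow> (v \<in> ext layered B \<longleftrightarrow> x \<in> ext I B)"
    using snd_in_dom basic_concept_layered_iff by (metis prod.collapse)
qed

end

section \<open>The finite model property\<close>

definition finite_pointed_model ::
  "'c set \<Rightarrow> 'r set \<Rightarrow> ('c, 'r) ontology \<Rightarrow> ('c, 'r) concept \<Rightarrow> ('d, 'c, 'r) interp \<Rightarrow> 'd \<Rightarrow> bool"
where
  "finite_pointed_model NC NR \<O> E I d \<longleftrightarrow>
     interpretation_over NC NR I \<and> finite (dom I) \<and> d \<in> dom I \<and> satisfies I \<O> \<and> d \<in> ext I E"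

lemma finite_pointed_model_transfer:
  fixes I :: "('d, 'c, 'r) interp"
  assumes inf: "infinite (UNIV :: 'e set)"
    and O: "dl_lite_ontology NC NR \<O>" and E: "concept_over NC NR E"
    and model: "finite_pointed_model NC NR \<O> E I d"
  obtains J :: "('e, 'c, 'r) interp" and v where "finite_pointed_model NC NR \<O> E J v"
proof -
  have I: "interpretation_over NC NR I" and fin: "finite (dom I)" and d: "d \<in> dom I"
    and sat: "satisfies I \<O>" and dE: "d \<in> ext I E"
    using model by (auto simp: finite_pointed_model_def)
  obtain T :: "'e set" where "finite T" "card T = card (dom I)"
    using infinite_arbitrarily_large[OF inf] by blast
  then obtain f :: "'d \<Rightarrow> 'e" where inj: "inj_on f (dom I)"
    using fin finite_same_card_bij[of "dom I" T] by (auto simp: bij_betw_def)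
  have "finite_pointed_model NC NR \<O> E (image_interp f I) (f d)"
    using fin d dE interpretation_over_image_interp[OF I] satisfies_image_interp[OF I inj O sat]
      ext_image_interp_iff[OF I inj E d]
    by (simp add: finite_pointed_model_def)
  then show thesis by (rule that)
qed

lemma finite_set_meeting_Ranges:
  assumes NR: "finite NR" and I: "interpretation_over NC NR I"
  obtains B where "finite B" "B \<subseteq> dom I"
    "\<And>S. role_over NR S \<Longrightarrow> role_ext I S \<noteq> {} \<Longrightarrow> B \<inter> Range (role_ext I S) \<noteq> {}"
proof -
  let ?roles = "{S. role_over NR S \<and> role_ext I S \<noteq> {}}"
  have "\<forall>S\<in>?roles. \<exists>y. y \<in> Range (role_ext I S)" by auto
  then obtain b where b: "\<And>S. S \<in> ?roles \<Longrightarrow> b S \<in> Range (role_ext I S)"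
    using bchoice[of ?roles "\<lambda>S y. y \<in> Range (role_ext I S)"] by blast
  show thesis
  proof
    show "finite (b ` ?roles)" using finite_role_over[OF NR] by simp
    show "b ` ?roles \<subseteq> dom I" using b role_ext_subset_dom[OF I] by blast
    show "b ` ?roles \<inter> Range (role_ext I S) \<noteq> {}" if "role_over NR S" "role_ext I S \<noteq> {}" for S
      using that b[of S] by blast
  qed
qed

theorem finite_model_property:
  fixes I :: "('d, 'c, 'r) interp"
  assumes inf: "infinite (UNIV :: 'e set)" and NR: "finite NR"
    and O: "dl_lite_ontology NC NR \<O>" and E: "concept_over NC NR E"
    and I: "interpretation_over NC NR I" and sat: "satisfies I \<O>" and d: "d \<in> ext I E"
  obtains J :: "('e, 'c, 'r) interp" and v where "finite_pointed_model NC NR \<O> E J v"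
proof -
  define \<Sigma> where "\<Sigma> = insert (1, UNIV) (demands I E)"
  have "finite \<Sigma>" by (simp add: \<Sigma>_def finite_demands)
  then have "\<exists>W. finite_witnesses \<Sigma> (role_ext I S `` {x}) W" for S x
    by (rule finite_witnesses_exists)
  then obtain wit where wit: "finite_witnesses \<Sigma> (role_ext I S `` {x}) (wit S x)" for S x
    by metis
  have d_dom: "d \<in> dom I" using ext_subset_dom[OF I E] d by blast
  obtain B where B: "finite B" "B \<subseteq> dom I"
    "\<And>S. role_over NR S \<Longrightarrow> role_ext I S \<noteq> {} \<Longrightarrow> B \<inter> Range (role_ext I S) \<noteq> {}"
    using finite_set_meeting_Ranges[OF NR I] by blast
  interpret layered_copy NC NR I "role_depth E" "insert d B" \<Sigma> wit
  proof
    show "(1, UNIV) \<in> \<Sigma>" by (simp add: \<Sigma>_def)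
    show "insert d B \<inter> Range (role_ext I S) \<noteq> {}" if "role_over NR S" "role_ext I S \<noteq> {}" for S
      using B(3)[OF that] by blast
  qed (simp_all add: NR I B(1,2) d_dom wit)
  have root: "(0, d) \<in> nodes" by (simp add: nodes_def)
  have "demands I E \<subseteq> \<Sigma>" by (auto simp: \<Sigma>_def)
  then have "(0, d) \<in> ext layered E"
    using original.ext_iff[of E "(0, d)" "role_depth E"] E root d by simp
  then have "finite_pointed_model NC NR \<O> E layered (0, d)"
    using interpretation_over_layered finite_nodes root satisfies_layered[OF O sat]
    by (simp add: finite_pointed_model_def)
  from finite_pointed_model_transfer[OF inf O E this] show thesis using that .
qed

lemma ext_neq_iff:
  assumes "interpretation_over NC NR I" "concept_over NC NR C" "concept_over NC NR D"
  shows "ext I C \<noteq> ext I D \<longleftrightarrow> (\<exists>d. d \<in> ext I (Disj (Conj C (Neg D)) (Conj (Neg C) D)))"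
  using assms(2,3)[THEN ext_subset_dom[OF assms(1)]] by auto

theorem theorem4:
  fixes NC :: "'c set" and NR :: "'r set"
    and C D :: "('c, 'r) concept"
    and \<O> :: "('c, 'r) ontology"
  assumes "finite NC" and "finite NR"
    and "concept_over NC NR C" and "concept_over NC NR D"
    and "dl_lite_ontology NC NR \<O>"
    and "infinite (UNIV :: 'd set)" and "infinite (UNIV :: 'e set)"
  shows "\<not> equiv_wrt TYPE('d) NC NR \<O> C D \<longleftrightarrow>
    (\<exists>(I :: ('e, 'c, 'r) interp) d.
       interpretation_over NC NR I \<and> finite (dom I) \<and> d \<in> dom I \<and> satisfies I \<O> \<and>
       d \<in> ext I (Disj (Conj C (Neg D)) (Conj (Neg C) D)))"
    (is "?inequivalent \<longleftrightarrow> ?separable")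
proof -
  let ?E = "Disj (Conj C (Neg D)) (Conj (Neg C) D)"
  have E: "concept_over NC NR ?E" using assms(3,4) by simp
  show ?thesis
  proof
    assume ?inequivalent
    then obtain I :: "('d, 'c, 'r) interp" and d
      where I: "interpretation_over NC NR I" "satisfies I \<O>" and d: "d \<in> ext I ?E"
      unfolding equiv_wrt_def using ext_neq_iff[OF _ assms(3,4)] by blast
    obtain J :: "('e, 'c, 'r) interp" and v where "finite_pointed_model NC NR \<O> ?E J v"
      by (rule finite_model_property[OF assms(7,2,5) E I d])
    then show ?separable unfolding finite_pointed_model_def by blast
  next
    assume ?separable
    then obtain I :: "('e, 'c, 'r) interp" and d where "finite_pointed_model NC NR \<O> ?E I d"
      unfolding finite_pointed_model_def by blast
    then obtain J :: "('d, 'c, 'r) interp" and v where J: "finite_pointed_model NC NR \<O> ?E J v"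
      by (rule finite_pointed_model_transfer[OF assms(6,5) E])
    then have "ext J C \<noteq> ext J D"
      using ext_neq_iff[OF _ assms(3,4)] unfolding finite_pointed_model_def by blast
    with J show ?inequivalent unfolding equiv_wrt_def finite_pointed_model_def by blast
  qed
qed

end
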